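(* Let $f(n)$, $n\in\mathbb{N}$, be a strictly increasing sequence of natural numbers with $f(n)=O(n^\tau)$ for some real $\tau\geqslant 1$. Then for every real $\alpha\in(1/2,1)$, $$\dim\mathcal{F}_{f,\alpha}\leqslant 1-\frac{2\alpha-1}{\tau},$$ where $\dim$ denotes Hausdorff dimension.
   Context: Write $\mathbf{e}(z)=\exp(2\pi i z)$ and $\mathsf{T}=[0,1]$. For a real sequence $f(n)$, $x\in\mathsf{T}$ and $N\in\mathbb{N}$ let $V_f(x;N)=\sum_{n=1}^N\mathbf{e}(xf(n))$, and for $\alpha\in(1/2,1)$ let $\mathcal{F}_{f,\alpha}=\{x\in\mathsf{T}:\ |V_f(x;N)|\geqslant N^\alpha\text{ for infinitely many }N\in\mathbb{N}\}$. *)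

theory Defs
  imports "HOL-Analysis.Analysis" "HOL-Library.Landau_Symbols"
begin

text \<open>
  The contribution of a covering set to the \<open>s\<close>-dimensional Hausdorff measure, with the usual
  convention that for \<open>s = 0\<close> every nonempty set counts 1. The case distinction is needed since
  \<^term>\<open>0 powr (0::real) = (0::real)\<close>.
\<close>
definition hausdorff_gauge :: "real \<Rightarrow> 'a::metric_space set \<Rightarrow> ennreal" where
  "hausdorff_gauge s U =
     (if U = {} then 0 else if s = 0 then 1 else ennreal (diameter U powr s))"

text \<open>
  Boundedness is required explicitly because \<^const>\<open>diameter\<close> is real-valued and carries no
  information for unbounded sets. Finite covers are included, by padding with the empty set.
\<close>
definition delta_covers :: "real \<Rightarrow> 'a::metric_space set \<Rightarrow> (nat \<Rightarrow> 'a set) set" where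
  "delta_covers \<delta> A =
     {U. A \<subseteq> (\<Union>i. U i) \<and> (\<forall>i. bounded (U i) \<and> diameter (U i) \<le> \<delta>)}"

definition hausdorff_content :: "real \<Rightarrow> real \<Rightarrow> 'a::metric_space set \<Rightarrow> ennreal" where
  "hausdorff_content \<delta> s A = (INF U \<in> delta_covers \<delta> A. \<Sum>i. hausdorff_gauge s (U i))"

definition hausdorff_measure :: "real \<Rightarrow> 'a::metric_space set \<Rightarrow> ennreal" where
  "hausdorff_measure s A = (SUP \<delta> \<in> {0<..}. hausdorff_content \<delta> s A)"

definition hausdorff_dim :: "'a::metric_space set \<Rightarrow> ereal" where
  "hausdorff_dim A = Inf (ereal ` {s. 0 \<le> s \<and> hausdorff_measure s A = 0})"

definition e_fun :: "complex \<Rightarrow> complex" where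
  "e_fun z = exp (2 * of_real pi * \<i> * z)"

definition V_sum :: "(nat \<Rightarrow> real) \<Rightarrow> real \<Rightarrow> nat \<Rightarrow> complex" where
  "V_sum f x N = (\<Sum>n=1..N. e_fun (of_real (x * f n)))"

definition F_set :: "(nat \<Rightarrow> real) \<Rightarrow> real \<Rightarrow> real set" where
  "F_set f \<alpha> =
     {x \<in> {0..1}. infinite {N. 1 \<le> N \<and> norm (V_sum f x N) \<ge> real N powr \<alpha>}}"

end

theory Submission
  imports Defs
begin

text \<open>
  Fix \<open>m\<close> and split \<open>[0, 1]\<close> into \<open>K \<approx> 2^(m\<tau>)\<close> equal cells. If \<open>|V(x; N)| \<ge> N^\<alpha>\<close> with
  \<open>2^(m - 1) \<le> N < 2^m\<close>, the binary expansion of \<open>N\<close> writes \<open>V(x; N)\<close> as at most \<open>m\<close> sums over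
  dyadic blocks, one of which has modulus at least \<open>2^((m - 1)\<alpha>) / (m + 1)\<close>. For a block of \<open>L\<close>
  terms the frequencies are \<open>O(K)\<close>, so Gallagher's form of the large sieve (a Sobolev inequality
  on each cell together with Parseval) shows that its sum reaches height \<open>\<kappa>\<close> on only
  \<open>O(K L / \<kappa>\<^sup>2)\<close> cells. The blocks of a given length have \<open>2^m\<close> terms altogether, hence
  \<open>O(m\<^sup>3 2^(m(1 - 2\<alpha>)) K)\<close> cells of length \<open>1 / K\<close> cover the exceptional \<open>x\<close> at scale \<open>m\<close>,
  and the resulting sums of \<open>s\<close>-th powers converge over \<open>m\<close> whenever \<open>s > 1 - (2\<alpha> - 1) / \<tau>\<close>.
\<close>

section \<open>Orthogonality of characters and Parseval's identity\<close>

lemma has_integral_cis_period: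
  fixes k :: int
  shows "((\<lambda>x. cis (2 * pi * of_int k * x)) has_integral (if k = 0 then 1 else 0)) {0..1}"
proof (cases "k = 0")
  case True
  then show ?thesis
    using has_integral_const_real[of "1::complex" 0 1] by simp
next
  case False
  define w :: complex where "w = 2 * of_real pi * of_int k * \<i>"
  have w: "w \<noteq> 0" using False by (simp add: w_def)
  have eq: "cis (2 * pi * of_int k * x) = exp (w * of_real x)" for x
    by (simp add: w_def cis_conv_exp mult_ac)
  have "((\<lambda>x. exp (w * of_real x)) has_integral (exp (w * of_real 1) / w - exp (w * of_real 0) / w)) {0..1}"
  proof (rule fundamental_theorem_of_calculus)
    show "((\<lambda>x. exp (w * of_real x) / w) has_vector_derivative exp (w * of_real x)) (at x within {0..1})" for x
    proof -
      have "((\<lambda>z. exp (w * z) / w) has_field_derivative exp (w * of_real x)) (at (of_real x))"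
        by (rule derivative_eq_intros refl | use w in simp)+
      then show ?thesis
        by (rule has_vector_derivative_real_field[THEN has_vector_derivative_at_within])
    qed
  qed simp
  moreover have "exp (w * of_real 1) = 1"
    using eq[of 1] cis_multiple_2pi[of "of_int k"] by (simp add: mult_ac)
  ultimately show ?thesis using False by (simp add: eq)
qed

text \<open>Parseval by expanding the square into a double sum: injectivity of \<open>f\<close>
  leaves only the diagonal after integration. Arbitrary coefficients \<open>c\<close> let the same
  identity serve a trigonometric sum and its derivative.\<close>

lemma has_integral_norm_trig_sum_squared:
  fixes c :: "'a \<Rightarrow> complex" and f :: "'a \<Rightarrow> nat"
  assumes "finite B" "inj_on f B"
  shows "((\<lambda>x. (cmod (\<Sum>n\<in>B. c n * cis (2 * pi * real (f n) * x)))\<^sup>2)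
           has_integral (\<Sum>n\<in>B. (cmod (c n))\<^sup>2)) {0..1}"
proof -
  let ?P = "\<lambda>x. \<Sum>n\<in>B. c n * cis (2 * pi * real (f n) * x)"
  let ?k = "\<lambda>m n. int (f m) - int (f n)"
  have expand: "complex_of_real ((cmod (?P x))\<^sup>2) =
      (\<Sum>m\<in>B. \<Sum>n\<in>B. c m * cnj (c n) * cis (2 * pi * of_int (?k m n) * x))" for x
  proof -
    have "complex_of_real ((cmod (?P x))\<^sup>2) = ?P x * cnj (?P x)"
      by (rule complex_norm_square)
    also have "\<dots> = (\<Sum>m\<in>B. \<Sum>n\<in>B. (c m * cis (2 * pi * real (f m) * x)) *
                     cnj (c n * cis (2 * pi * real (f n) * x)))"
      by (simp only: cnj_sum sum_product)
    also have "\<dots> = (\<Sum>m\<in>B. \<Sum>n\<in>B. c m * cnj (c n) * cis (2 * pi * of_int (?k m n) * x))"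
    proof (intro sum.cong refl)
      fix m n
      have "cis (2 * pi * real (f m) * x) * cis (- (2 * pi * real (f n) * x)) =
            cis (2 * pi * of_int (?k m n) * x)"
        by (simp add: cis_mult algebra_simps)
      then show "(c m * cis (2 * pi * real (f m) * x)) * cnj (c n * cis (2 * pi * real (f n) * x)) =
            c m * cnj (c n) * cis (2 * pi * of_int (?k m n) * x)"
        by (simp add: cis_cnj mult_ac)
    qed
    finally show ?thesis .
  qed
  have "((\<lambda>x. complex_of_real ((cmod (?P x))\<^sup>2)) has_integral
          (\<Sum>m\<in>B. \<Sum>n\<in>B. c m * cnj (c n) * (if ?k m n = 0 then 1 else 0))) {0..1}"
    unfolding expand
    by (intro has_integral_sum assms has_integral_mult_right has_integral_cis_period)
  also have "(\<Sum>m\<in>B. \<Sum>n\<in>B. c m * cnj (c n) * (if ?k m n = 0 then 1 else 0)) =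
             (\<Sum>m\<in>B. \<Sum>n\<in>B. if m = n then c m * cnj (c n) else 0)"
    using assms(2) by (intro sum.cong) (auto simp: inj_on_def)
  also have "\<dots> = (\<Sum>m\<in>B. complex_of_real ((cmod (c m))\<^sup>2))"
    using assms(1) by (simp add: sum.delta complex_norm_square[symmetric] del: of_real_power)
  finally have "((\<lambda>x. Re (complex_of_real ((cmod (?P x))\<^sup>2))) has_integral
          Re (\<Sum>m\<in>B. complex_of_real ((cmod (c m))\<^sup>2))) {0..1}"
    by (rule has_integral_linear[OF _ bounded_linear_Re, unfolded o_def])
  then show ?thesis by (simp del: of_real_power)
qed

section \<open>Gallagher's large sieve\<close>

text \<open>Gallagher's Sobolev inequality: \<open>g x\<close> exceeds \<open>g t\<close> by at most
  the integral of \<open>h\<close>, and this is integrated over \<open>t\<close>. A continuous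
  majorant \<open>h\<close> replaces \<open>\<bar>g' t\<bar>\<close>, so no continuity of
  \<open>g'\<close> has to be assumed.\<close>

lemma interval_sup_le_integral:
  fixes g g' h :: "real \<Rightarrow> real"
  assumes "a \<le> x" "x \<le> b"
    and deriv: "\<And>t. t \<in> {a..b} \<Longrightarrow> (g has_real_derivative g' t) (at t)"
    and bound: "\<And>t. t \<in> {a..b} \<Longrightarrow> \<bar>g' t\<bar> \<le> h t"
    and h: "continuous_on {a..b} h"
  shows "(b - a) * g x \<le> integral {a..b} (\<lambda>t. g t + (b - a) * h t)"
proof -
  have hpos: "0 \<le> h t" if "t \<in> {a..b}" for t using bound[OF that] by linarith
  have hint: "h integrable_on {u..v}" if "a \<le> u" "v \<le> b" for u v
    using that by (intro integrable_continuous_real continuous_on_subset[OF h]) auto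
  have gint: "g integrable_on {a..b}"
    using deriv by (intro integrable_continuous_real DERIV_continuous_on) (blast intro: has_field_derivative_at_within)
  have sub: "integral {u..v} h \<le> integral {a..b} h" if "a \<le> u" "v \<le> b" for u v
    using that hpos by (intro integral_subset_le hint) auto
  have diff: "\<bar>g v - g u\<bar> \<le> integral {a..b} h" if "a \<le> u" "u \<le> v" "v \<le> b" for u v
  proof -
    have "(g' has_integral (g v - g u)) {u..v}"
      using that by (intro fundamental_theorem_of_calculus)
        (auto simp: has_real_derivative_iff_has_vector_derivative[symmetric] intro!: has_field_derivative_at_within deriv)
    then have "g v - g u = integral {u..v} g'" "g' integrable_on {u..v}"
      by (auto simp: integral_unique has_integral_integrable)
    moreover have "norm (integral {u..v} g') \<le> integral {u..v} h"
      using that bound calculation by (intro integral_norm_bound_integral hint) auto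
    ultimately show ?thesis using sub[of u v] that by auto
  qed
  have "integral {a..b} (\<lambda>t. g x) \<le> integral {a..b} (\<lambda>t. g t + integral {a..b} h)"
  proof (rule integral_le)
    fix t assume "t \<in> {a..b}"
    then show "g x \<le> g t + integral {a..b} h"
      using diff[of x t] diff[of t x] assms(1,2) by (cases "x \<le> t") auto
  qed (auto intro!: integrable_add gint)
  also have "\<dots> = integral {a..b} g + (b - a) * integral {a..b} h"
    using assms(1,2) by (subst integral_add) (auto intro: gint)
  also have "\<dots> = integral {a..b} (\<lambda>t. g t + (b - a) * h t)"
    by (subst integral_add) (auto intro!: gint hint integrable_on_mult_right)
  finally show ?thesis using assms(1,2) by simp
qed

lemma sum_integral_equal_parts:
  fixes w :: "real \<Rightarrow> real" and K :: nat
  assumes "continuous_on UNIV w" "n \<le> K"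
  shows "(\<Sum>j<n. integral {real j / real K..(real j + 1) / real K} w) = integral {0..real n / real K} w"
  using \<open>n \<le> K\<close>
proof (induction n)
  case (Suc n)
  have "w integrable_on {0..(real n + 1) / real K}"
    by (intro integrable_continuous_real continuous_on_subset[OF assms(1)]) auto
  then have "integral {0..real n / real K} w + integral {real n / real K..(real n + 1) / real K} w =
             integral {0..(real n + 1) / real K} w"
    by (intro Henstock_Kurzweil_Integration.integral_combine) (auto simp: divide_right_mono)
  with Suc show ?case by (simp add: add.commute)
qed simp

text \<open>Every cell on which the sum reaches height \<open>\<kappa>\<close> carries at least
  \<open>\<kappa>\<^sup>2\<close> of the integral of a fixed nonnegative weight. Since the cells
  tile the unit interval, the number of such cells is controlled by the total integral, which
  Parseval evaluates.\<close>

lemma card_large_values_trig_sum: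
  fixes f :: "'a \<Rightarrow> nat" and K :: nat and C \<kappa> :: real
  assumes "finite B" "inj_on f B" "K > 0" and fC: "\<And>n. n \<in> B \<Longrightarrow> real (f n) \<le> C * real K"
    and "\<kappa> > 0"
  shows "real (card {j\<in>{..<K}. \<exists>x\<in>{real j / real K..(real j + 1) / real K}.
            \<kappa> \<le> cmod (\<Sum>n\<in>B. cis (2 * pi * real (f n) * x))}) * \<kappa>\<^sup>2
         \<le> (2 + 4 * pi\<^sup>2 * C\<^sup>2) * real K * real (card B)"
proof -
  \<comment> \<open>The factor \<open>1\<close> exhibits the coefficients, so that Parseval applies
    to \<open>F\<close> and its derivative \<open>D\<close> in the same form.\<close>
  define F where "F = (\<lambda>x. \<Sum>n\<in>B. 1 * cis (2 * pi * real (f n) * x))"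
  define D where "D = (\<lambda>x. \<Sum>n\<in>B. (\<i> * of_real (2 * pi * real (f n))) * cis (2 * pi * real (f n) * x))"
  \<comment> \<open>\<open>w\<close> is \<open>K\<close> times the Sobolev integrand for
    \<open>(cmod (F x))\<^sup>2\<close> on a cell of length \<open>1 / K\<close>, with
    \<open>h\<close> as the majorant of the derivative.\<close>
  define w where "w = (\<lambda>x. 2 * real K * (cmod (F x))\<^sup>2 + (cmod (D x))\<^sup>2 / real K)"
  define h where "h = (\<lambda>x. real K * (cmod (F x))\<^sup>2 + (cmod (D x))\<^sup>2 / real K)"
  define J where "J = {j\<in>{..<K}. \<exists>x\<in>{real j / real K..(real j + 1) / real K}. \<kappa> \<le> cmod (F x)}"
  have ccis: "continuous_on UNIV (\<lambda>x. cis (a * x))" for a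
    by (simp add: cis_conv_exp) (intro continuous_intros)
  have contF: "continuous_on UNIV F" and contD: "continuous_on UNIV D"
    unfolding F_def D_def by (intro continuous_intros ccis)+
  have contw: "continuous_on UNIV w" and conth: "continuous_on UNIV h"
    unfolding w_def h_def using \<open>K > 0\<close> by (intro continuous_intros contF contD; simp)+
  have wpos: "0 \<le> w x" for x by (simp add: w_def)
  have dcis: "((\<lambda>x. cis (a * x)) has_vector_derivative (\<i> * of_real a) * cis (a * x)) (at x)" for a x
  proof -
    have "((\<lambda>z. exp (\<i> * of_real a * z)) has_field_derivative (\<i> * of_real a) * exp (\<i> * of_real a * of_real x))
            (at (of_real x))"
      by (rule derivative_eq_intros refl | simp)+
    from has_vector_derivative_real_field[OF this] show ?thesis
      by (simp add: cis_conv_exp mult_ac)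
  qed
  have dF: "(F has_vector_derivative D x) (at x)" for x
    unfolding F_def D_def mult_1_left by (intro has_vector_derivative_sum dcis)
  have dg: "((\<lambda>x. (cmod (F x))\<^sup>2) has_real_derivative 2 * (F x \<bullet> D x)) (at x)" for x
    using bounded_bilinear.has_vector_derivative[OF bounded_bilinear_inner dF dF, of x]
    by (simp add: has_real_derivative_iff_has_vector_derivative power2_norm_eq_inner inner_commute)
  \<comment> \<open>AM-GM in place of the Cauchy--Schwarz inequality for integrals.\<close>
  have bound: "\<bar>2 * (F x \<bullet> D x)\<bar> \<le> h x" for x
  proof -
    have "\<bar>2 * (F x \<bullet> D x)\<bar> \<le> 2 * (cmod (F x) * cmod (D x))"
      using Cauchy_Schwarz_ineq2[of "F x" "D x"] by simp
    also have "\<dots> \<le> h x"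
    proof -
      have "0 \<le> (real K * cmod (F x) - cmod (D x))\<^sup>2 / real K" by simp
      also have "\<dots> = h x - 2 * (cmod (F x) * cmod (D x))"
        using \<open>K > 0\<close> by (simp add: h_def field_simps power2_eq_square)
      finally show ?thesis by simp
    qed
    finally show ?thesis .
  qed
  have local: "\<kappa>\<^sup>2 \<le> integral {real j / real K..(real j + 1) / real K} w" if j: "j \<in> J" for j
  proof -
    from j obtain x where x: "real j / real K \<le> x" "x \<le> (real j + 1) / real K" "\<kappa> \<le> cmod (F x)"
      by (auto simp: J_def)
    have len: "(real j + 1) / real K - real j / real K = 1 / real K"
      by (simp add: diff_divide_distrib[symmetric])
    have "1 / real K * (cmod (F x))\<^sup>2 \<le>
        integral {real j / real K..(real j + 1) / real K} (\<lambda>t. (cmod (F t))\<^sup>2 + 1 / real K * h t)"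
      using interval_sup_le_integral[OF x(1,2) dg bound continuous_on_subset[OF conth]]
      by (simp add: len)
    also have "(\<lambda>t. (cmod (F t))\<^sup>2 + 1 / real K * h t) = (\<lambda>t. 1 / real K * w t)"
      using \<open>K > 0\<close> by (auto simp: h_def w_def field_simps)
    finally have "(cmod (F x))\<^sup>2 \<le> integral {real j / real K..(real j + 1) / real K} w"
      using \<open>K > 0\<close> by (simp add: divide_simps)
    moreover have "\<kappa>\<^sup>2 \<le> (cmod (F x))\<^sup>2" using x(3) \<open>\<kappa> > 0\<close> by (intro power_mono) auto
    ultimately show ?thesis by linarith
  qed
  have "real (card J) * \<kappa>\<^sup>2 = (\<Sum>j\<in>J. \<kappa>\<^sup>2)" by simp
  also have "\<dots> \<le> (\<Sum>j\<in>J. integral {real j / real K..(real j + 1) / real K} w)"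
    by (intro sum_mono local)
  also have "\<dots> \<le> (\<Sum>j<K. integral {real j / real K..(real j + 1) / real K} w)"
    by (intro sum_mono2 integral_nonneg integrable_continuous_real continuous_on_subset[OF contw])
       (auto simp: J_def wpos)
  also have "\<dots> = integral {0..1} w"
    using sum_integral_equal_parts[OF contw order_refl, of K] \<open>K > 0\<close> by simp
  also have "\<dots> = 2 * real K * (\<Sum>n\<in>B. (cmod 1)\<^sup>2) +
                  (\<Sum>n\<in>B. (cmod (\<i> * of_real (2 * pi * real (f n))))\<^sup>2) / real K"
    unfolding w_def F_def D_def
    by (intro integral_unique has_integral_add has_integral_mult_right has_integral_divide
          has_integral_norm_trig_sum_squared assms)
  \<comment> \<open>The bound \<open>C * K\<close> on the frequencies makes the derivative term,
    after division by \<open>K\<close>, of the same order \<open>K * card B\<close> as the main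
    term.\<close>
  also have "\<dots> \<le> 2 * real K * real (card B) + (\<Sum>n\<in>B. (2 * pi * (C * real K))\<^sup>2) / real K"
    using fC by (intro add_mono divide_right_mono sum_mono)
      (auto simp: norm_mult power_mult_distrib intro!: mult_left_mono power_mono
         simp flip: power_mult_distrib)
  also have "\<dots> = (2 + 4 * pi\<^sup>2 * C\<^sup>2) * real K * real (card B)"
    using \<open>K > 0\<close> by (simp add: field_simps power2_eq_square)
  finally show ?thesis by (simp add: J_def F_def)
qed

section \<open>Dyadic decomposition of partial sums\<close>

text \<open>The binary digits of \<open>N\<close> are read from the top. A new digit 0 leaves the
  endpoint unchanged, and a new digit 1 appends exactly one dyadic block, so \<open>m\<close> digits
  cost at most \<open>m\<close> blocks.\<close>

lemma norm_sum_le_dyadic_blocks: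
  fixes u :: "nat \<Rightarrow> 'a::real_normed_vector"
  assumes block: "\<And>i q. i < m \<Longrightarrow> q < 2 ^ (m - i) \<Longrightarrow>
      norm (\<Sum>n\<in>{q * 2 ^ i<..Suc q * 2 ^ i}. u n) \<le> \<kappa>"
    and "N < 2 ^ m"
  shows "norm (\<Sum>n\<in>{0<..N}. u n) \<le> real m * \<kappa>"
proof -
  \<comment> \<open>Here \<open>q\<close> stands for the number formed by the leading
    \<open>d\<close> of \<open>m\<close> digits; for \<open>d = m\<close> the endpoint is
    \<open>N\<close> itself.\<close>
  have "norm (\<Sum>n\<in>{0<..q * 2 ^ (m - d)}. u n) \<le> real d * \<kappa>" if "d \<le> m" "q < 2 ^ d" for d q
    using that
  proof (induction d arbitrary: q)
    case (Suc d)
    define r where "r = q div 2"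
    have r: "r < 2 ^ d" using Suc.prems by (auto simp: r_def)
    have pow: "(2::nat) ^ (m - d) = 2 * 2 ^ (m - Suc d)"
      using Suc.prems by (simp flip: power_Suc add: Suc_diff_Suc)
    have IH: "norm (\<Sum>n\<in>{0<..r * 2 * 2 ^ (m - Suc d)}. u n) \<le> real d * \<kappa>"
      using Suc.IH[OF _ r] Suc.prems by (simp add: pow mult_ac)
    have b: "norm (\<Sum>n\<in>{(r * 2) * 2 ^ (m - Suc d)<..Suc (r * 2) * 2 ^ (m - Suc d)}. u n) \<le> \<kappa>"
    proof (rule block)
      have "m - (m - Suc d) = Suc d" using Suc.prems by simp
      then show "r * 2 < 2 ^ (m - (m - Suc d))" using r by simp
    qed (use Suc.prems in simp)
    \<comment> \<open>Nonnegativity of \<open>\<kappa>\<close> comes from the bounded block; it is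
      what allows \<open>d\<close> to be raised to \<open>Suc d\<close> when no block is
      added.\<close>
    have l: "0 \<le> \<kappa>" using b norm_ge_zero order_trans by blast
    show ?case
    proof (cases "even q")
      case True
      then have "q = r * 2" by (simp add: r_def)
      with IH l show ?thesis by (simp add: distrib_right)
    next
      case False
      then have q: "q = Suc (r * 2)" by (simp add: r_def odd_iff_mod_2_eq_one) presburger
      have "{0<..q * 2 ^ (m - Suc d)} =
          {0<..r * 2 * 2 ^ (m - Suc d)} \<union> {(r * 2) * 2 ^ (m - Suc d)<..Suc (r * 2) * 2 ^ (m - Suc d)}"
        by (auto simp: q)
      then have "(\<Sum>n\<in>{0<..q * 2 ^ (m - Suc d)}. u n) = (\<Sum>n\<in>{0<..r * 2 * 2 ^ (m - Suc d)}. u n) +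
          (\<Sum>n\<in>{(r * 2) * 2 ^ (m - Suc d)<..Suc (r * 2) * 2 ^ (m - Suc d)}. u n)"
        by (simp only:) (rule sum.union_disjoint, auto)
      then show ?thesis using norm_triangle_mono[OF IH b] by (simp only:) (simp add: distrib_right add.commute)
    qed
  qed simp
  from this[of m N] assms(2) show ?thesis by simp
qed

section \<open>Hausdorff measure and dimension of limsup sets\<close>

text \<open>The convergence half of Borel-Cantelli for Hausdorff measure: the cells of all levels
  \<open>m \<ge> M\<close> still cover \<open>A\<close>, and both their diameters and the tail of
  the series become arbitrarily small as \<open>M\<close> grows.\<close>

lemma hausdorff_measure_limsup_eq_0:
  fixes I :: "nat \<Rightarrow> nat \<Rightarrow> 'a::metric_space set" and J :: "nat \<Rightarrow> nat set" and \<delta> :: "nat \<Rightarrow> real"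
  assumes "s > 0"
    and cover: "\<And>x M. x \<in> A \<Longrightarrow> \<exists>m\<ge>M. \<exists>j\<in>J m. x \<in> I m j"
    and fin: "\<And>m. finite (J m)"
    and bdd: "\<And>m j. bounded (I m j)" and diam: "\<And>m j. diameter (I m j) \<le> \<delta> m"
    and lim: "\<delta> \<longlonglongrightarrow> 0"
    and summ: "summable (\<lambda>m. real (card (J m)) * \<delta> m powr s)"
  shows "hausdorff_measure s A = 0"
proof -
  have "hausdorff_content \<epsilon> s A \<le> ennreal e" if "\<epsilon> > 0" "e > 0" for \<epsilon> e
  proof -
    have "eventually (\<lambda>m. \<delta> m < \<epsilon>) sequentially"
      using lim \<open>\<epsilon> > 0\<close> by (rule order_tendstoD)
    then obtain M1 where M1: "\<And>m. m \<ge> M1 \<Longrightarrow> \<delta> m < \<epsilon>"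
      by (auto simp: eventually_sequentially)
    obtain M2 where M2: "\<And>M. M \<ge> M2 \<Longrightarrow> norm (\<Sum>i. real (card (J (i + M))) * \<delta> (i + M) powr s) < e"
      using suminf_exist_split[OF \<open>e > 0\<close> summ] by auto
    define M where "M = max M1 M2"
    \<comment> \<open>Padding with empty sets of gauge 0 makes the family total in
      \<open>(i, j)\<close>; \<open>prod_decode\<close> then flattens it to the single sequence that
      \<open>delta_covers\<close> requires.\<close>
    define W where "W = (\<lambda>(i, j). if j \<in> J (i + M) then I (i + M) j else {})"
    define U where "U = (\<lambda>n. W (prod_decode n))"
    \<comment> \<open>For the padding sets this needs \<open>\<delta> \<ge> 0\<close>, which follows
      since \<open>\<delta>\<close> bounds diameters.\<close>
    have diamW: "diameter (W (i, j)) \<le> \<delta> (i + M)" for i j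
      using diam[of "i + M" j] diameter_ge_0[OF bdd, of "i + M" j] by (auto simp: W_def)
    have "U \<in> delta_covers \<epsilon> A"
      unfolding delta_covers_def mem_Collect_eq
    proof (intro conjI allI subsetI)
      fix x assume "x \<in> A"
      then obtain m j where mj: "m \<ge> M" "j \<in> J m" "x \<in> I m j" using cover by blast
      then have "x \<in> U (prod_encode (m - M, j))" by (simp add: U_def W_def)
      then show "x \<in> (\<Union>i. U i)" by blast
    next
      fix n
      obtain i j where ij: "prod_decode n = (i, j)" by force
      show "bounded (U n)" using bdd by (simp add: U_def ij W_def)
      show "diameter (U n) \<le> \<epsilon>"
        using diamW[of i j] M1[of "i + M", OF trans_le_add2] by (simp add: U_def ij M_def)
    qed
    then have "hausdorff_content \<epsilon> s A \<le> (\<Sum>n. hausdorff_gauge s (U n))"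
      unfolding hausdorff_content_def by (rule INF_lower)
    also have "\<dots> = (\<Sum>i. \<Sum>j. hausdorff_gauge s (W (i, j)))"
      unfolding U_def by (rule suminf_ennreal_2dimen) simp
    also have "\<dots> \<le> (\<Sum>i. ennreal (real (card (J (i + M))) * \<delta> (i + M) powr s))"
    proof (intro suminf_le summableI)
      fix i
      have "(\<Sum>j. hausdorff_gauge s (W (i, j))) = (\<Sum>j\<in>J (i + M). hausdorff_gauge s (W (i, j)))"
        using fin by (intro suminf_finite) (auto simp: W_def hausdorff_gauge_def)
      also have "\<dots> \<le> (\<Sum>j\<in>J (i + M). ennreal (\<delta> (i + M) powr s))"
      proof (rule sum_mono)
        fix j
        have "bounded (W (i, j))" using bdd by (simp add: W_def)
        then have "diameter (W (i, j)) powr s \<le> \<delta> (i + M) powr s"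
          using diamW[of i j] \<open>s > 0\<close> by (intro powr_mono2) (auto intro: diameter_ge_0)
        then show "hausdorff_gauge s (W (i, j)) \<le> ennreal (\<delta> (i + M) powr s)"
          using \<open>s > 0\<close> by (auto simp: hausdorff_gauge_def intro: ennreal_leI)
      qed
      also have "\<dots> = ennreal (real (card (J (i + M))) * \<delta> (i + M) powr s)"
        by (simp add: ennreal_mult ennreal_of_nat_eq_real_of_nat)
      finally show "(\<Sum>j. hausdorff_gauge s (W (i, j))) \<le> \<dots>" .
    qed
    also have "\<dots> = ennreal (\<Sum>i. real (card (J (i + M))) * \<delta> (i + M) powr s)"
      using summ by (intro suminf_ennreal2) (auto simp: summable_iff_shift[of "\<lambda>m. real (card (J m)) * \<delta> m powr s"])
    also have "\<dots> \<le> ennreal e"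
      using M2[of M] by (intro ennreal_leI) (simp add: M_def)
    finally show ?thesis .
  qed
  then have "hausdorff_content \<epsilon> s A = 0" if "\<epsilon> > 0" for \<epsilon>
    using that ennreal_le_epsilon[of 0 "hausdorff_content \<epsilon> s A"] by simp
  then show ?thesis by (simp add: hausdorff_measure_def)
qed

text \<open>Exponents just above \<open>s0\<close> already determine the bound. The window up to
  \<open>t\<close> allows the later estimates to assume \<open>s < 1\<close>.\<close>

lemma hausdorff_dim_le:
  assumes "s0 < t" "s0 \<ge> 0" "\<And>s. s0 < s \<Longrightarrow> s < t \<Longrightarrow> hausdorff_measure s A = 0"
  shows "hausdorff_dim A \<le> ereal s0"
proof (rule dense_ge_bounded)
  show "ereal s0 < ereal t" using assms by simp
  fix r assume r: "ereal s0 < r" "r < ereal t"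
  then obtain s where "r = ereal s" by (cases r) auto
  then show "hausdorff_dim A \<le> r"
    using r assms(2,3) unfolding hausdorff_dim_def by (intro Inf_lower) auto
qed

section \<open>Auxiliary facts on series, cells and growth\<close>

text \<open>Three termwise differentiations of the geometric series give the coefficients
  \<open>(n + 1) * (n + 2) * (n + 3)\<close>, which dominate \<open>(n + 1) ^ 3\<close>.\<close>

lemma summable_cube_times_geometric:
  fixes \<rho> :: real
  assumes "\<bar>\<rho>\<bar> < 1"
  shows "summable (\<lambda>m. (real m + 1) ^ 3 * \<rho> ^ m)"
proof -
  define c where "c = (\<lambda>n::nat. 1 :: real)"
  have 0: "summable (\<lambda>n. c n * x ^ n)" if "norm x < 1" for x
    using that by (simp add: c_def summable_geometric)
  have 1: "summable (\<lambda>n. diffs c n * x ^ n)" if "norm x < 1" for x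
    by (rule termdiff_converges[OF that 0])
  have 2: "summable (\<lambda>n. diffs (diffs c) n * x ^ n)" if "norm x < 1" for x
    by (rule termdiff_converges[OF that 1])
  have 3: "summable (\<lambda>n. diffs (diffs (diffs c)) n * \<bar>\<rho>\<bar> ^ n)"
    using assms by (intro termdiff_converges[OF _ 2]) auto
  show ?thesis
  proof (rule summable_comparison_test'[OF 3])
    fix n :: nat
    have "(real n + 1) ^ 3 \<le> diffs (diffs (diffs c)) n"
      by (simp add: diffs_def c_def algebra_simps power3_eq_cube)
    then show "norm ((real n + 1) ^ 3 * \<rho> ^ n) \<le> diffs (diffs (diffs c)) n * \<bar>\<rho>\<bar> ^ n"
      by (simp add: abs_mult power_abs mult_right_mono)
  qed
qed

lemma unit_interval_equal_parts:
  fixes x :: real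
  assumes "0 \<le> x" "x \<le> 1" "K > 0"
  shows "\<exists>j<K. x \<in> {real j / real K..(real j + 1) / real K}"
\<comment> \<open>At \<open>x = 1\<close> the floor would give the nonexistent index
  \<open>K\<close>; the last closed cell contains this point.\<close>
proof (cases "x = 1")
  case True
  with assms show ?thesis by (intro exI[of _ "K - 1"]) (auto simp: of_nat_diff)
next
  case False
  define j where "j = nat \<lfloor>x * real K\<rfloor>"
  have "real j = of_int \<lfloor>x * real K\<rfloor>" using assms by (simp add: j_def)
  then have "real j \<le> x * real K" "x * real K < real j + 1" by linarith+
  moreover from this have "real j < real K"
    using False assms mult_strict_right_mono[of x 1 "real K"] by linarith
  ultimately show ?thesis using assms by (intro exI[of _ j]) (auto simp: field_simps)
qed

lemma bigo_powr_imp_bound: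
  fixes f :: "nat \<Rightarrow> nat"
  assumes "(\<lambda>n. real (f n)) \<in> O(\<lambda>n. real n powr \<tau>)" "\<tau> \<ge> 0"
  shows "\<exists>C. \<forall>n\<ge>1. real (f n) \<le> C * real n powr \<tau>"
proof -
  obtain c where "c > 0" and "eventually (\<lambda>n. norm (real (f n)) \<le> c * norm (real n powr \<tau>)) sequentially"
    using landau_o.bigE[OF assms(1)] by blast
  then obtain n0 where c: "\<And>n. n \<ge> n0 \<Longrightarrow> real (f n) \<le> c * real n powr \<tau>"
    by (auto simp: eventually_sequentially)
  \<comment> \<open>The sum absorbs the finitely many values before \<open>n0\<close>, because
    \<open>n powr \<tau> \<ge> 1\<close> once \<open>n \<ge> 1\<close>.\<close>
  define C where "C = c + (\<Sum>n<n0. real (f n))"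
  have "real (f n) \<le> C * real n powr \<tau>" if "n \<ge> 1" for n
  proof -
    have p: "1 \<le> real n powr \<tau>" using that assms(2) by (intro ge_one_powr_ge_zero) auto
    show ?thesis
    proof (cases "n \<ge> n0")
      case True
      have "c * real n powr \<tau> \<le> C * real n powr \<tau>"
        by (intro mult_right_mono) (auto simp: C_def sum_nonneg)
      with c[OF True] show ?thesis by linarith
    next
      case False
      then have "real (f n) \<le> (\<Sum>n<n0. real (f n))" by (intro member_le_sum) auto
      then have "real (f n) \<le> C * 1" using \<open>c > 0\<close> by (simp add: C_def)
      also have "C * 1 \<le> C * real n powr \<tau>"
        using p \<open>c > 0\<close> by (intro mult_left_mono) (auto simp: C_def intro!: add_nonneg_nonneg sum_nonneg)
      finally show ?thesis .
    qed
  qed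
  then show ?thesis by blast
qed

section \<open>Cells with a large dyadic block: counting and covering\<close>

lemma V_sum_conv_cis:
  "V_sum (\<lambda>n. real (f n)) x N = (\<Sum>n\<in>{0<..N}. cis (2 * pi * real (f n) * x))"
  unfolding V_sum_def
  by (intro sum.cong) (auto simp: e_fun_def cis_conv_exp mult_ac)

definition dyadic_block :: "nat \<Rightarrow> nat \<Rightarrow> nat set" where
  "dyadic_block i q = {q * 2 ^ i<..Suc q * 2 ^ i}"

text \<open>
  Dividing by \<open>m + 1\<close> is the pigeonhole loss: a partial sum of length in \<open>[2^(m - 1), 2^m)\<close> splits
  into at most \<open>m\<close> dyadic blocks.
\<close>
definition block_threshold :: "real \<Rightarrow> nat \<Rightarrow> real" where
  "block_threshold \<alpha> m = 2 powr ((real m - 1) * \<alpha>) / (real m + 1)"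

text \<open>For each \<open>i < m\<close> the \<open>2 ^ (m - i)\<close> blocks of length
  \<open>2 ^ i\<close> tile \<open>{1..2 ^ m}\<close>.\<close>

definition large_cells :: "(nat \<Rightarrow> nat) \<Rightarrow> real \<Rightarrow> nat \<Rightarrow> nat \<Rightarrow> nat set" where
  "large_cells f \<alpha> K m = (\<Union>(i, q) \<in> Sigma {..<m} (\<lambda>i. {..<2 ^ (m - i)}).
     {j\<in>{..<K}. \<exists>x\<in>{real j / real K..(real j + 1) / real K}.
        block_threshold \<alpha> m \<le> cmod (\<Sum>n\<in>dyadic_block i q. cis (2 * pi * real (f n) * x))})"

lemma finite_large_cells: "finite (large_cells f \<alpha> K m)"
  by (auto simp: large_cells_def)

lemma dyadic_block_subset:
  assumes "i < m" "q < 2 ^ (m - i)"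
  shows "dyadic_block i q \<subseteq> {1..2 ^ m}"
proof -
  have "Suc q * 2 ^ i \<le> 2 ^ (m - i) * 2 ^ i" using assms by (intro mult_right_mono) auto
  also have "\<dots> = 2 ^ m" using assms by (simp flip: power_add)
  finally show ?thesis by (auto simp: dyadic_block_def)
qed

text \<open>The large sieve charges each block in proportion to its length, so every level
  \<open>i\<close> costs the same multiple of \<open>2 ^ m\<close>; the union over levels loses only
  the factor \<open>m\<close>.\<close>

lemma card_large_cells:
  assumes "strict_mono_on {1..} f" "K > 0"
    and fC: "\<And>n. n \<in> {1..2 ^ m} \<Longrightarrow> real (f n) \<le> C * real K"
  shows "real (card (large_cells f \<alpha> K m)) * (block_threshold \<alpha> m)\<^sup>2 \<le> (2 + 4 * pi\<^sup>2 * C\<^sup>2) * real K * (real m * 2 ^ m)"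
proof -
  define S where "S = (SIGMA i:{..<m}. {..<(2::nat) ^ (m - i)})"
  define L where "L = (\<lambda>(i, q). {j\<in>{..<K}. \<exists>x\<in>{real j / real K..(real j + 1) / real K}.
        block_threshold \<alpha> m \<le> cmod (\<Sum>n\<in>dyadic_block i q. cis (2 * pi * real (f n) * x))})"
  have finS: "finite S" by (simp add: S_def)
  have lev: "block_threshold \<alpha> m > 0" by (simp add: block_threshold_def add_pos_nonneg)
  have "large_cells f \<alpha> K m = (\<Union>p\<in>S. L p)"
    by (auto simp: large_cells_def S_def L_def)
  then have "real (card (large_cells f \<alpha> K m)) \<le> (\<Sum>p\<in>S. real (card (L p)))"
    using card_UN_le[OF finS, of L] by (simp flip: of_nat_sum)
  then have "real (card (large_cells f \<alpha> K m)) * (block_threshold \<alpha> m)\<^sup>2 \<le> (\<Sum>p\<in>S. real (card (L p))) * (block_threshold \<alpha> m)\<^sup>2"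
    by (intro mult_right_mono) auto
  also have "\<dots> = (\<Sum>p\<in>S. real (card (L p)) * (block_threshold \<alpha> m)\<^sup>2)"
    by (rule sum_distrib_right)
  also have "\<dots> \<le> (\<Sum>(i, q)\<in>S. (2 + 4 * pi\<^sup>2 * C\<^sup>2) * real K * 2 ^ i)"
  proof (rule sum_mono)
    fix p assume "p \<in> S"
    then obtain i q where p: "p = (i, q)" "i < m" "q < 2 ^ (m - i)" by (auto simp: S_def)
    have sub: "dyadic_block i q \<subseteq> {1..2 ^ m}" by (rule dyadic_block_subset[OF p(2,3)])
    have card: "card (dyadic_block i q) = 2 ^ i" by (simp add: dyadic_block_def)
    have "inj_on f (dyadic_block i q)"
      by (rule inj_on_subset[OF strict_mono_on_imp_inj_on[OF assms(1)]]) (use sub in auto)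
    moreover have "finite (dyadic_block i q)" by (simp add: dyadic_block_def)
    ultimately have "real (card (L (i, q))) * (block_threshold \<alpha> m)\<^sup>2
        \<le> (2 + 4 * pi\<^sup>2 * C\<^sup>2) * real K * real (card (dyadic_block i q))"
      unfolding L_def prod.case
      using sub fC lev \<open>K > 0\<close> by (intro card_large_values_trig_sum) blast+
    then show "real (card (L p)) * (block_threshold \<alpha> m)\<^sup>2 \<le> (case p of (i, q) \<Rightarrow> (2 + 4 * pi\<^sup>2 * C\<^sup>2) * real K * 2 ^ i)"
      by (simp add: p card)
  qed
  also have "\<dots> = (\<Sum>i<m. \<Sum>q<(2::nat) ^ (m - i). (2 + 4 * pi\<^sup>2 * C\<^sup>2) * real K * 2 ^ i)"
    unfolding S_def by (subst sum.Sigma) auto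
  also have "\<dots> = (\<Sum>i<m. (2 + 4 * pi\<^sup>2 * C\<^sup>2) * real K * 2 ^ m)"
  proof (rule sum.cong[OF refl])
    fix i assume "i \<in> {..<m}"
    then have "(2::real) ^ m = 2 ^ (m - i) * 2 ^ i" by (simp flip: power_add)
    then show "(\<Sum>q<(2::nat) ^ (m - i). (2 + 4 * pi\<^sup>2 * C\<^sup>2) * real K * 2 ^ i) = (2 + 4 * pi\<^sup>2 * C\<^sup>2) * real K * 2 ^ m"
      by simp
  qed
  finally show ?thesis by (simp add: mult_ac)
qed

text \<open>If all blocks stayed below the threshold, the dyadic decomposition would force the
  partial sum below \<open>N powr \<alpha>\<close>. Infinitely many \<open>N\<close> provide such a
  level \<open>m\<close> beyond any \<open>M\<close>.\<close>

lemma F_set_covered_by_large_cells: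
  assumes "x \<in> F_set (\<lambda>n. real (f n)) \<alpha>" "\<alpha> > 0" "\<And>m. K m > 0"
  shows "\<exists>m\<ge>M. \<exists>j\<in>large_cells f \<alpha> (K m) m. x \<in> {real j / real (K m)..(real j + 1) / real (K m)}"
proof -
  have x: "0 \<le> x" "x \<le> 1"
    and inf: "infinite {N. 1 \<le> N \<and> norm (V_sum (\<lambda>n. real (f n)) x N) \<ge> real N powr \<alpha>}"
    using assms(1) by (auto simp: F_set_def)
  from inf obtain N where N: "2 ^ M \<le> N" "1 \<le> N" "real N powr \<alpha> \<le> norm (V_sum (\<lambda>n. real (f n)) x N)"
    unfolding infinite_nat_iff_unbounded_le by blast
  obtain k where k: "2 ^ k \<le> N" "N < 2 ^ (k + 1)" using ex_power_ivl1[of 2 N] N(2) by auto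
  define m where "m = k + 1"
  have "(2::nat) ^ M < 2 ^ m" using N(1) k(2) unfolding m_def by (rule le_less_trans)
  then have "M \<le> m" by simp
  \<comment> \<open>Strict because \<open>m / (m + 1) < 1\<close>; this yields the contradiction
    with the lower bound on the sum.\<close>
  have "real m * block_threshold \<alpha> m < 2 powr ((real m - 1) * \<alpha>)"
    by (simp add: block_threshold_def field_simps)
  also have "\<dots> = real (2 ^ k) powr \<alpha>"
    by (simp add: m_def powr_powr flip: powr_realpow)
  also have "\<dots> \<le> real N powr \<alpha>"
    using of_nat_mono[OF k(1), where 'a = real] \<open>\<alpha> > 0\<close> by (intro powr_mono2) auto
  also have "\<dots> \<le> norm (\<Sum>n\<in>{0<..N}. cis (2 * pi * real (f n) * x))"
    using N(3) by (simp add: V_sum_conv_cis)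
  finally have "\<not> norm (\<Sum>n\<in>{0<..N}. cis (2 * pi * real (f n) * x)) \<le> real m * block_threshold \<alpha> m" by simp
  then obtain i q where iq: "i < m" "q < 2 ^ (m - i)"
      "block_threshold \<alpha> m \<le> norm (\<Sum>n\<in>dyadic_block i q. cis (2 * pi * real (f n) * x))"
    using norm_sum_le_dyadic_blocks[of m "\<lambda>n. cis (2 * pi * real (f n) * x)" "block_threshold \<alpha> m" N] k(2)
    unfolding dyadic_block_def m_def by (meson linear)
  obtain j where j: "j < K m" "x \<in> {real j / real (K m)..(real j + 1) / real (K m)}"
    using unit_interval_equal_parts[OF x assms(3)] by blast
  have "j \<in> large_cells f \<alpha> (K m) m"
    unfolding large_cells_def using iq j by (intro UN_I[of "(i, q)"]) auto
  then show ?thesis using j \<open>M \<le> m\<close> by blast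
qed

section \<open>Vanishing measure above the critical exponent, and the dimension bound\<close>

text \<open>Number of cells times cell length to the power \<open>s\<close> is at most a constant
  times \<open>(m + 1) ^ 3 * \<rho> ^ m\<close>, and the lower bound on \<open>s\<close> is
  precisely the condition \<open>\<rho> < 1\<close>.\<close>

lemma hausdorff_measure_F_set_eq_0:
  fixes f :: "nat \<Rightarrow> nat"
  assumes mono: "strict_mono_on {1..} f" and "\<tau> \<ge> 1"
    and bigo: "(\<lambda>n. real (f n)) \<in> O(\<lambda>n. real n powr \<tau>)"
    and "0 < \<alpha>" "\<alpha> < 1" and s: "1 - (2 * \<alpha> - 1) / \<tau> < s" "0 < s" "s < 1"
  shows "hausdorff_measure s (F_set (\<lambda>n. real (f n)) \<alpha>) = 0"
proof -
  obtain C where C: "\<And>n. n \<ge> 1 \<Longrightarrow> real (f n) \<le> C * real n powr \<tau>"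
    using bigo_powr_imp_bound[OF bigo] \<open>\<tau> \<ge> 1\<close> by auto
  have "C \<ge> 0" using C[of 1] by simp
  \<comment> \<open>With about \<open>2 powr (m * \<tau>)\<close> cells, the frequencies
    \<open>f n\<close> for \<open>n \<le> 2 ^ m\<close> are at most \<open>C * K m\<close>, as the
    large sieve requires; rounding up costs at most a factor 2.\<close>
  define K where "K = (\<lambda>m::nat. nat \<lceil>2 powr (real m * \<tau>)\<rceil>)"
  define P where "P = 2 + 4 * pi\<^sup>2 * C\<^sup>2"
  \<comment> \<open>In the exponent, \<open>1\<close> comes from the \<open>2 ^ m\<close> terms,
    \<open>- 2 * \<alpha>\<close> from the squared threshold, and \<open>\<tau> * (1 - s)\<close>
    from \<open>K\<close> cells weighted by \<open>K powr (- s)\<close>.\<close>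
  define \<rho> where "\<rho> = 2 powr (1 - 2 * \<alpha> + \<tau> * (1 - s))"
  have K_ge: "2 powr (real m * \<tau>) \<le> real (K m)" for m by (simp add: K_def)
  have one_le: "1 \<le> 2 powr (real m * \<tau>)" for m using \<open>\<tau> \<ge> 1\<close> by (intro ge_one_powr_ge_zero) auto
  have K_le: "real (K m) \<le> 2 * 2 powr (real m * \<tau>)" for m
    using one_le[of m] by (simp add: K_def) linarith
  have K_pos: "K m > 0" for m using K_ge[of m] one_le[of m] by (cases "K m") auto
  have fK: "real (f n) \<le> C * real (K m)" if "n \<in> {1..2 ^ m}" for n m
  proof -
    have "real n \<le> 2 ^ m" using that of_nat_mono[of n "2 ^ m", where 'a = real] by simp
    then have "real n powr \<tau> \<le> (2 ^ m) powr \<tau>" using \<open>\<tau> \<ge> 1\<close> by (intro powr_mono2) auto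
    also have "\<dots> = 2 powr (real m * \<tau>)" by (simp add: powr_powr flip: powr_realpow)
    also have "\<dots> \<le> real (K m)" by (rule K_ge)
    finally have "C * real n powr \<tau> \<le> C * real (K m)" using \<open>C \<ge> 0\<close> by (rule mult_left_mono)
    then show ?thesis using C[of n] that by auto
  qed
  \<comment> \<open>The 8 is 2 from the rounding in \<open>K\<close> times 4 bounding
    \<open>2 powr (2 * \<alpha>)\<close>, the price of \<open>m - 1\<close> in the threshold. The
    cube is one factor from the number of levels and two from the squared threshold.\<close>
  have bound: "real (card (large_cells f \<alpha> (K m) m)) * (1 / real (K m)) powr s
                 \<le> 8 * P * ((real m + 1) ^ 3 * \<rho> ^ m)" for m
  proof -
    define Q where "Q = 2 powr (2 * (real m - 1) * \<alpha>)"
    have Q: "Q > 0" by (simp add: Q_def)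
    have lev: "(block_threshold \<alpha> m)\<^sup>2 = Q / (real m + 1)\<^sup>2"
    proof -
      have "2 * (real m - 1) * \<alpha> = (real m - 1) * \<alpha> + (real m - 1) * \<alpha>" by simp
      then have "Q = (2 powr ((real m - 1) * \<alpha>))\<^sup>2"
        unfolding Q_def power2_eq_square by (simp only: powr_add)
      then show ?thesis by (simp add: block_threshold_def power_divide)
    qed
    have "real (card (large_cells f \<alpha> (K m) m)) * (Q / (real m + 1)\<^sup>2) \<le> P * real (K m) * (real m * 2 ^ m)"
      using card_large_cells[OF mono K_pos fK, of m m \<alpha>] by (simp add: P_def lev)
    then have "real (card (large_cells f \<alpha> (K m) m)) \<le> P * real (K m) * (real m * 2 ^ m) * (real m + 1)\<^sup>2 / Q"
      using Q by (simp add: pos_le_divide_eq pos_divide_le_eq add_nonneg_pos)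
    then have "real (card (large_cells f \<alpha> (K m) m)) * (1 / real (K m)) powr s
        \<le> (P * real (K m) * (real m * 2 ^ m) * (real m + 1)\<^sup>2 / Q) * (1 / real (K m)) powr s"
      by (intro mult_right_mono) auto
    also have "\<dots> = P * (real (K m) powr (1 - s)) * 2 ^ m * (real m * (real m + 1)\<^sup>2) / Q"
      using K_pos[of m] by (simp add: powr_divide powr_diff mult_ac)
    also have "\<dots> \<le> P * (2 * 2 powr (real m * \<tau> * (1 - s))) * 2 ^ m * (real m + 1) ^ 3 / Q"
    proof (intro divide_right_mono mult_mono mult_left_mono)
      have "real (K m) powr (1 - s) \<le> (2 * 2 powr (real m * \<tau>)) powr (1 - s)"
        using s K_le by (intro powr_mono2) auto
      also have "\<dots> = 2 powr (1 - s) * 2 powr (real m * \<tau> * (1 - s))"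
        by (simp add: powr_mult powr_powr)
      also have "\<dots> \<le> 2 * 2 powr (real m * \<tau> * (1 - s))"
        using s powr_mono[of "1 - s" 1 2] by (intro mult_right_mono) auto
      finally show "real (K m) powr (1 - s) \<le> 2 * 2 powr (real m * \<tau> * (1 - s))" .
      show "real m * (real m + 1)\<^sup>2 \<le> (real m + 1) ^ 3"
        unfolding power3_eq_cube power2_eq_square by (simp add: algebra_simps)
    qed (use Q in \<open>auto simp: P_def\<close>)
    also have "\<dots> = P * 2 * (real m + 1) ^ 3 * 2 powr (real m * \<tau> * (1 - s) + real m - 2 * (real m - 1) * \<alpha>)"
      by (simp add: Q_def powr_add powr_diff powr_realpow)
    also have "real m * \<tau> * (1 - s) + real m - 2 * (real m - 1) * \<alpha> =
               (1 - 2 * \<alpha> + \<tau> * (1 - s)) * real m + 2 * \<alpha>"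
      by (simp add: algebra_simps)
    also have "2 powr ((1 - 2 * \<alpha> + \<tau> * (1 - s)) * real m + 2 * \<alpha>) = \<rho> ^ m * 2 powr (2 * \<alpha>)"
    proof -
      have "\<rho> ^ m = 2 powr ((1 - 2 * \<alpha> + \<tau> * (1 - s)) * real m)"
        using powr_realpow[of \<rho> m] unfolding \<rho>_def powr_powr by simp
      then show ?thesis by (simp only: powr_add)
    qed
    also have "P * 2 * (real m + 1) ^ 3 * (\<rho> ^ m * 2 powr (2 * \<alpha>)) \<le> P * 2 * (real m + 1) ^ 3 * (\<rho> ^ m * 4)"
    proof (intro mult_left_mono)
      show "2 powr (2 * \<alpha>) \<le> (4::real)" using powr_mono[of "2 * \<alpha>" 2 2] \<open>\<alpha> < 1\<close> by simp
    qed (auto simp: P_def \<rho>_def)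
    finally show ?thesis by (simp add: mult_ac)
  qed
  show ?thesis
  proof (rule hausdorff_measure_limsup_eq_0)
    show "\<exists>m\<ge>M. \<exists>j\<in>large_cells f \<alpha> (K m) m. x \<in> {real j / real (K m)..(real j + 1) / real (K m)}"
      if "x \<in> F_set (\<lambda>n. real (f n)) \<alpha>" for x M
      using F_set_covered_by_large_cells[OF that \<open>0 < \<alpha>\<close> K_pos] .
    show "diameter {real j / real (K m)..(real j + 1) / real (K m)} \<le> 1 / real (K m)" for m j
      by (subst diameter_closed_interval) (auto simp: divide_right_mono diff_divide_distrib[symmetric])
    have "\<bar>\<rho>\<bar> < 1"
    proof -
      have "\<tau> * (1 - s) < 2 * \<alpha> - 1" using s \<open>\<tau> \<ge> 1\<close> by (simp add: field_simps)
      then have "\<rho> < 2 powr 0" unfolding \<rho>_def by (intro powr_less_mono) auto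
      then show ?thesis by (simp add: \<rho>_def)
    qed
    then show "summable (\<lambda>m. real (card (large_cells f \<alpha> (K m) m)) * (1 / real (K m)) powr s)"
      using bound by (intro summable_comparison_test'[OF summable_mult[OF summable_cube_times_geometric]]) auto
    show "(\<lambda>m. 1 / real (K m)) \<longlonglongrightarrow> 0"
    proof (rule tendsto_sandwich[OF _ _ tendsto_const])
      show "(\<lambda>m. (1/2 :: real) ^ m) \<longlonglongrightarrow> 0" by (rule LIMSEQ_realpow_zero) auto
      have "1 / real (K m) \<le> (1 / 2) ^ m" for m
      proof -
        have "(2::real) ^ m = 2 powr (real m * 1)" by (simp add: powr_realpow)
        also have "\<dots> \<le> 2 powr (real m * \<tau>)" using \<open>\<tau> \<ge> 1\<close> by (intro powr_mono mult_left_mono) auto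
        also have "\<dots> \<le> real (K m)" by (rule K_ge)
        finally show ?thesis using K_pos[of m] by (simp add: field_simps)
      qed
      then show "eventually (\<lambda>m. 1 / real (K m) \<le> (1 / 2) ^ m) sequentially" by simp
    qed simp
  qed (use s finite_large_cells in auto)
qed

theorem theorem3p7:
  fixes f :: "nat \<Rightarrow> nat" and \<tau> \<alpha> :: real
  assumes "strict_mono_on {1..} f"
    and "\<tau> \<ge> 1"
    and "(\<lambda>n. real (f n)) \<in> O(\<lambda>n. real n powr \<tau>)"
    and "1/2 < \<alpha>" and "\<alpha> < 1"
  shows "hausdorff_dim (F_set (\<lambda>n. real (f n)) \<alpha>) \<le> ereal (1 - (2 * \<alpha> - 1) / \<tau>)"
proof (rule hausdorff_dim_le)
  show "1 - (2 * \<alpha> - 1) / \<tau> < 1" using assms by simp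
  \<comment> \<open>This follows from \<open>2 * \<alpha> - 1 < 1 \<le> \<tau>\<close>; it also
    supplies \<open>0 < s\<close> for every exponent considered below.\<close>
  show nonneg: "0 \<le> 1 - (2 * \<alpha> - 1) / \<tau>" using assms by (simp add: field_simps)
  show "hausdorff_measure s (F_set (\<lambda>n. real (f n)) \<alpha>) = 0"
    if "1 - (2 * \<alpha> - 1) / \<tau> < s" "s < 1" for s
    using that le_less_trans[OF nonneg that(1)] assms
    by (intro hausdorff_measure_F_set_eq_0[where \<tau> = \<tau>]) auto
qed

end
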